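(* A $t_*$ Massart margin implies an $(\alpha,\beta,\gamma)$ Boltzmann margin for $\alpha,\beta,\gamma>0$ satisfying $\alpha\exp\left(-\frac{\gamma}{t_*^{\beta}}\right)=1$. Reversely, for any $t_*>0$, a $(1,\beta,t_*^\beta)$ Boltzmann margin approaches the $t_*$ Massart margin condition as $\beta\to\infty$, provided that $|1/2-\eta(X)|\ne t_*$ almost everywhere.
   Context: $(X,Y)$ is a random pair in $\mathcal{X}\times\{0,1\}$, where $\mathcal{X}$ is a normed data space, and $\eta(x)=\mathbb{E}[Y\mid X=x]$ is the posterior function. The margin conditions are properties of the distribution of $(X,Y)$. $t_*$ Massart margin ($t_*>0$ a constant): $\Pr_X\{|1/2-\eta(X)|\le t_*\}=0$. $(\alpha,\beta,\gamma)$ Boltzmann margin ($\alpha,\beta,\gamma>0$ constants): for all $t>0$, $\Pr_X\{|1/2-\eta(X)|\le t\}\le\alpha\exp(-\gamma t^{-\beta})$. *)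

theory Defs
  imports "HOL-Probability.Probability"
begin

text \<open>
  The posterior function \<open>\<eta>(x) = E[Y | X = x]\<close> is only determined up to null sets of the law
  of \<open>X\<close>. The predicate says that \<open>\<eta>\<close> is a (Borel) version of it, that is, \<open>\<eta>(X)\<close> is a version
  of the conditional expectation of \<open>Y\<close> given the sigma-algebra generated by \<open>X\<close>.
\<close>

definition posterior_function ::
  "'w measure \<Rightarrow> ('w \<Rightarrow> 'a::real_normed_vector) \<Rightarrow> ('w \<Rightarrow> real) \<Rightarrow> ('a \<Rightarrow> real) \<Rightarrow> bool" where
  "posterior_function M X Y \<eta> \<longleftrightarrow>
     \<eta> \<in> borel_measurable borel \<and>
     (AE \<omega> in M. \<eta> (X \<omega>) = real_cond_exp M (vimage_algebra (space M) X borel) Y \<omega>)"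

text \<open>
  The margin conditions depend on the distribution of \<open>(X, Y)\<close> only through the law \<open>P\<close> of \<open>X\<close>
  and the posterior function; \<open>margin_prob P \<eta> t\<close> is \<open>Pr_X {|1/2 - \<eta>(X)| \<le> t}\<close>.
\<close>

definition margin_prob :: "'a::real_normed_vector measure \<Rightarrow> ('a \<Rightarrow> real) \<Rightarrow> real \<Rightarrow> real" where
  "margin_prob P \<eta> t = measure P {x \<in> space P. \<bar>1/2 - \<eta> x\<bar> \<le> t}"

definition massart_margin :: "'a::real_normed_vector measure \<Rightarrow> ('a \<Rightarrow> real) \<Rightarrow> real \<Rightarrow> bool" where
  "massart_margin P \<eta> s \<longleftrightarrow> s > 0 \<and> margin_prob P \<eta> s = 0"

definition boltzmann_bound :: "real \<Rightarrow> real \<Rightarrow> real \<Rightarrow> real \<Rightarrow> real" where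
  "boltzmann_bound \<alpha> \<beta> \<gamma> t = \<alpha> * exp (- (\<gamma> * t powr (- \<beta>)))"

definition boltzmann_margin ::
  "'a::real_normed_vector measure \<Rightarrow> ('a \<Rightarrow> real) \<Rightarrow> real \<Rightarrow> real \<Rightarrow> real \<Rightarrow> bool" where
  "boltzmann_margin P \<eta> \<alpha> \<beta> \<gamma> \<longleftrightarrow>
     \<alpha> > 0 \<and> \<beta> > 0 \<and> \<gamma> > 0 \<and> (\<forall>t>0. margin_prob P \<eta> t \<le> boltzmann_bound \<alpha> \<beta> \<gamma> t)"

end

theory Submission
  imports Defs "HOL-Real_Asymp.Real_Asymp"
begin

text \<open>
  The bound of the $(1, \beta, s^\beta)$ Boltzmann margin is $\exp(-(s/t)^\beta)$, which tends, as
  $\beta \to \infty$, to the step function that is $0$ for $t < s$, $e^{-1}$ at $t = s$ and $1$ for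
  $t > s$. Lying below this limit means that no mass sits at distance less than $s$ from $1/2$; mass
  at distance exactly $s$ is only controlled by $e^{-1}$, so it must be excluded separately.
\<close>

lemma margin_prob_eq_0_iff_AE:
  assumes "prob_space P" and [measurable]: "\<eta> \<in> borel_measurable P"
  shows "margin_prob P \<eta> t = 0 \<longleftrightarrow> (AE x in P. t < \<bar>1/2 - \<eta> x\<bar>)"
proof -
  interpret prob_space P by fact
  have "{x \<in> space P. \<bar>1/2 - \<eta> x\<bar> \<le> t} \<in> events"
    by measurable
  then have "margin_prob P \<eta> t = 0 \<longleftrightarrow> (AE x in P. \<not> \<bar>1/2 - \<eta> x\<bar> \<le> t)"
    unfolding margin_prob_def by (rule prob_Collect_eq_0)
  then show ?thesis
    by (simp add: not_le)
qed

lemma margin_prob_mono: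
  assumes "prob_space P" and [measurable]: "\<eta> \<in> borel_measurable P" and "t \<le> u"
  shows "margin_prob P \<eta> t \<le> margin_prob P \<eta> u"
proof -
  interpret prob_space P by fact
  show ?thesis
    unfolding margin_prob_def using \<open>t \<le> u\<close> by (intro finite_measure_mono) auto
qed

lemma margin_prob_le_1: "prob_space P \<Longrightarrow> margin_prob P \<eta> t \<le> 1"
  unfolding margin_prob_def by (rule prob_space.prob_le_1)

lemma margin_prob_nonneg: "0 \<le> margin_prob P \<eta> t"
  by (simp add: margin_prob_def)

text \<open>Continuity of measure from below: the event of distance less than s from 1/2 is a
  countable union of null events of distance at most t with 0 < t < s, and \<open>neq\<close>
  removes distance exactly s. Both forms of the converse reduce to this.\<close>

lemma massart_margin_if_margin_prob_below:
  assumes P: "prob_space P" and \<eta>: "\<eta> \<in> borel_measurable P" and "s > 0"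
    and neq: "AE x in P. \<bar>1/2 - \<eta> x\<bar> \<noteq> s"
    and below: "\<And>t. 0 < t \<Longrightarrow> t < s \<Longrightarrow> margin_prob P \<eta> t \<le> 0"
  shows "massart_margin P \<eta> s"
proof -
  \<comment> \<open>The shift by 2 makes \<open>u 0 = s / 2\<close> positive; \<open>below\<close>
    speaks only of thresholds strictly between 0 and s.\<close>
  define u where "u n = s * (1 - 1 / (real n + 2))" for n
  have u: "0 < u n" "u n < s" for n
    using \<open>s > 0\<close> by (auto simp: u_def field_simps intro: add_pos_nonneg)
  have "u \<longlonglongrightarrow> s"
    unfolding u_def by real_asymp
  have "AE x in P. u n < \<bar>1/2 - \<eta> x\<bar>" for n
    using below[OF u, of n] margin_prob_nonneg[of P \<eta> "u n"]
    by (simp flip: margin_prob_eq_0_iff_AE[OF P \<eta>])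
  \<comment> \<open>One null set serves all n, so the limit in n can be taken at each remaining
    point.\<close>
  then have "AE x in P. \<forall>n. u n < \<bar>1/2 - \<eta> x\<bar>"
    by (simp add: AE_all_countable)
  with neq have "AE x in P. s < \<bar>1/2 - \<eta> x\<bar>"
  proof eventually_elim
    case (elim x)
    then have "s \<le> \<bar>1/2 - \<eta> x\<bar>"
      using \<open>u \<longlonglongrightarrow> s\<close> by (intro LIMSEQ_le_const2) (auto intro: less_imp_le)
    with elim show ?case
      by simp
  qed
  then show ?thesis
    using \<open>s > 0\<close> by (simp add: massart_margin_def margin_prob_eq_0_iff_AE[OF P \<eta>])
qed

text \<open>The equation on \<alpha>, \<beta>, \<gamma> says that the Boltzmann bound equals 1 at t
  = s, and the bound increases with t. Beyond s it is therefore at least 1; up to s the left side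
  vanishes by monotonicity.\<close>

lemma massart_imp_boltzmann_margin:
  assumes P: "prob_space P" and \<eta>: "\<eta> \<in> borel_measurable P" and "massart_margin P \<eta> s"
    and pos: "\<alpha> > 0" "\<beta> > 0" "\<gamma> > 0" and eq: "\<alpha> * exp (- (\<gamma> / s powr \<beta>)) = 1"
  shows "boltzmann_margin P \<eta> \<alpha> \<beta> \<gamma>"
  unfolding boltzmann_margin_def
proof (intro conjI allI impI pos)
  fix t :: real assume "t > 0"
  from \<open>massart_margin P \<eta> s\<close> have "s > 0" and 0: "margin_prob P \<eta> s = 0"
    by (auto simp: massart_margin_def)
  show "margin_prob P \<eta> t \<le> boltzmann_bound \<alpha> \<beta> \<gamma> t"
  proof (cases "t \<le> s")
    case True
    have "margin_prob P \<eta> t \<le> 0"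
      using margin_prob_mono[OF P \<eta> True] 0 by simp
    also have "0 \<le> boltzmann_bound \<alpha> \<beta> \<gamma> t"
      using pos by (simp add: boltzmann_bound_def)
    finally show ?thesis .
  next
    case False
    then have "t powr (- \<beta>) \<le> s powr (- \<beta>)"
      using \<open>s > 0\<close> pos by (intro powr_mono2') auto
    then have "\<gamma> * t powr (- \<beta>) \<le> \<gamma> / s powr \<beta>"
      using pos by (simp add: powr_minus divide_inverse)
    \<comment> \<open>Writing 1 as the value of the bound at s leaves only a comparison of
      exponents.\<close>
    then have "1 \<le> boltzmann_bound \<alpha> \<beta> \<gamma> t"
      unfolding boltzmann_bound_def eq[symmetric] using pos by simp
    then show ?thesis
      using margin_prob_le_1[OF P, of \<eta> t] by linarith
  qed
qed

text \<open>The powers of s and t combine into a power of r = s / t, so only the position of r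
  relative to 1 matters.\<close>

lemma tendsto_boltzmann_bound:
  fixes s t :: real
  assumes "s > 0" "t > 0"
  shows "((\<lambda>\<beta>. boltzmann_bound 1 \<beta> (s powr \<beta>) t) \<longlongrightarrow>
           (if t < s then 0 else if t = s then exp (- 1) else 1)) at_top"
proof -
  define r where "r = s / t"
  have "r > 0"
    using assms by (simp add: r_def)
  have eq: "boltzmann_bound 1 \<beta> (s powr \<beta>) t = exp (- (r powr \<beta>))" for \<beta>
    using assms by (simp add: r_def boltzmann_bound_def powr_divide powr_minus_divide)
  consider "t < s" | "t = s" | "s < t"
    by linarith
  then show ?thesis
  proof cases
    case 1
    \<comment> \<open>As \<open>r powr \<beta> = exp (\<beta> * ln r)\<close>, the sign of
      \<open>ln r\<close> decides between growth to infinity and decay to 0.\<close>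
    then have "ln r > 0"
      using assms by (simp add: r_def)
    with \<open>r > 0\<close> have "((\<lambda>\<beta>. exp (- (r powr \<beta>))) \<longlongrightarrow> 0) at_top"
      by real_asymp
    with 1 show ?thesis
      unfolding eq by simp
  next
    case 2
    then have "r = 1"
      using assms by (simp add: r_def)
    with 2 show ?thesis
      unfolding eq by simp
  next
    case 3
    then have "ln r < 0"
      using assms by (simp add: r_def)
    with \<open>r > 0\<close> have "((\<lambda>\<beta>. exp (- (r powr \<beta>))) \<longlongrightarrow> 1) at_top"
      by real_asymp
    with 3 show ?thesis
      unfolding eq by simp
  qed
qed

text \<open>One precise sense of "approaches": replacing the bounds by their pointwise limit turns
  the Boltzmann condition into the Massart condition.\<close>

lemma margin_prob_le_limit_iff_massart:
  assumes P: "prob_space P" and \<eta>: "\<eta> \<in> borel_measurable P" and "s > 0"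
    and neq: "AE x in P. \<bar>1/2 - \<eta> x\<bar> \<noteq> s"
  shows "(\<forall>t>0. margin_prob P \<eta> t \<le> (if t < s then 0 else if t = s then exp (- 1) else 1))
           \<longleftrightarrow> massart_margin P \<eta> s"
proof
  assume le: "\<forall>t>0. margin_prob P \<eta> t \<le> (if t < s then 0 else if t = s then exp (- 1) else 1)"
  show "massart_margin P \<eta> s"
    using P \<eta> \<open>s > 0\<close> neq
  proof (rule massart_margin_if_margin_prob_below)
    fix t assume "0 < t" "t < s"
    then show "margin_prob P \<eta> t \<le> 0"
      using le by (metis (full_types))
  qed
next
  assume "massart_margin P \<eta> s"
  then have "margin_prob P \<eta> t \<le> 0" if "t \<le> s" for t
    using margin_prob_mono[OF P \<eta> that] by (simp add: massart_margin_def)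
  then show "\<forall>t>0. margin_prob P \<eta> t \<le> (if t < s then 0 else if t = s then exp (- 1) else 1)"
    using margin_prob_le_1[OF P, of \<eta>] by (auto intro: order_trans[of _ 0])
qed

text \<open>A second sense, with the margin conditions themselves for arbitrarily large \<beta>. If
  some t < s had positive margin probability, the bound at t, tending to 0, would eventually drop
  below it and refute the Boltzmann margin for all large \<beta>.\<close>

lemma frequently_boltzmann_imp_massart_margin:
  assumes P: "prob_space P" and \<eta>: "\<eta> \<in> borel_measurable P" and "s > 0"
    and neq: "AE x in P. \<bar>1/2 - \<eta> x\<bar> \<noteq> s"
    and freq: "\<exists>\<^sub>F \<beta> in at_top. boltzmann_margin P \<eta> 1 \<beta> (s powr \<beta>)"
  shows "massart_margin P \<eta> s"
  using P \<eta> \<open>s > 0\<close> neq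
proof (rule massart_margin_if_margin_prob_below)
  fix t assume t: "0 < t" "t < s"
  show "margin_prob P \<eta> t \<le> 0"
  proof (rule ccontr)
    assume "\<not> margin_prob P \<eta> t \<le> 0"
    moreover have "((\<lambda>\<beta>. boltzmann_bound 1 \<beta> (s powr \<beta>) t) \<longlongrightarrow> 0) at_top"
      using tendsto_boltzmann_bound[OF \<open>s > 0\<close> t(1)] t(2) by simp
    ultimately have "\<forall>\<^sub>F \<beta> in at_top. boltzmann_bound 1 \<beta> (s powr \<beta>) t < margin_prob P \<eta> t"
      by (intro order_tendstoD) auto
    then have "\<forall>\<^sub>F \<beta> in at_top. \<not> boltzmann_margin P \<eta> 1 \<beta> (s powr \<beta>)"
      by eventually_elim (use t(1) in \<open>auto simp: boltzmann_margin_def not_le\<close>)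
    with freq show False
      by (simp add: frequently_def)
  qed
qed

theorem lemma3p1:
  fixes M :: "'w measure"
    and X :: "'w \<Rightarrow> 'a::real_normed_vector"
    and Y :: "'w \<Rightarrow> real"
    and \<eta> :: "'a \<Rightarrow> real"
    and P :: "'a measure"
    and s :: real
  defines "P \<equiv> distr M borel X"
  assumes "prob_space M"
    and "X \<in> borel_measurable M"
    and "Y \<in> borel_measurable M"
    and "\<And>\<omega>. \<omega> \<in> space M \<Longrightarrow> Y \<omega> \<in> {0, 1}"
    and "posterior_function M X Y \<eta>"
    and "s > 0"
  shows "(massart_margin P \<eta> s \<longrightarrow>
            (\<forall>\<alpha> \<beta> \<gamma>. \<alpha> > 0 \<longrightarrow> \<beta> > 0 \<longrightarrow> \<gamma> > 0 \<longrightarrow>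
               \<alpha> * exp (- (\<gamma> / s powr \<beta>)) = 1 \<longrightarrow> boltzmann_margin P \<eta> \<alpha> \<beta> \<gamma>)) \<and>
         ((AE x in P. \<bar>1/2 - \<eta> x\<bar> \<noteq> s) \<longrightarrow>
            (\<exists>L. (\<forall>t>0. ((\<lambda>\<beta>. boltzmann_bound 1 \<beta> (s powr \<beta>) t) \<longlongrightarrow> L t) at_top) \<and>
                 ((\<forall>t>0. margin_prob P \<eta> t \<le> L t) \<longleftrightarrow> massart_margin P \<eta> s)) \<and>
            ((\<exists>\<^sub>F \<beta> in at_top. boltzmann_margin P \<eta> 1 \<beta> (s powr \<beta>)) \<longrightarrow> massart_margin P \<eta> s))"
proof -
  have P: "prob_space P"
    unfolding P_def using assms(2,3) by (rule prob_space.prob_space_distr)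
  have \<eta>: "\<eta> \<in> borel_measurable P"
    using assms(6) by (simp add: posterior_function_def P_def)
  \<comment> \<open>The witness for L is the step function computed above. By uniqueness of limits L
    is determined on t > 0, so the existential leaves no freedom there.\<close>
  show ?thesis
    using massart_imp_boltzmann_margin[OF P \<eta>] tendsto_boltzmann_bound[OF \<open>s > 0\<close>]
      margin_prob_le_limit_iff_massart[OF P \<eta> \<open>s > 0\<close>]
      frequently_boltzmann_imp_massart_margin[OF P \<eta> \<open>s > 0\<close>]
    by (intro conjI impI allI
        exI[where x = "\<lambda>t. if t < s then 0 else if t = s then exp (- 1) else 1"]) auto
qed

end
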